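(* Illumination surface bodies need not be convex, even for a Euclidean ball and a smooth function $f$. Precisely: let $K=B_2^2$ be the Euclidean unit disc in $\mathbb{R}^2$, let $s=\frac1{64}$, and define $f:\partial K\to\mathbb{R}$ by $$f(x)=\begin{cases}\frac{1}{4\pi}, & x \text{ in the first or third quadrant},\\[2pt] \frac{1}{16\pi}, & x\text{ in the fourth quadrant},\\[2pt] \frac{23}{16\pi}, & x\text{ in the second quadrant}.\end{cases}$$ Then $K^{f,s}$ is not convex. Moreover, there is also a smooth nonnegative function $f:\partial K\to\mathbb{R}$ for which $K^{f,s}$ is not convex.
   Context: For a convex body $K\subset\mathbb{R}^n$ with boundary surface measure $\mu_K$, a nonnegative integrable $f:\partial K\to\mathbb{R}$ and $s\ge0$, put $\mu_f(A)=\int_A f\,d\mu_K$ and let $[x,K]$ be the convex hull of $\{x\}\cup K$. The illumination surface body is $$K^{f,s}=\{x\in\mathbb{R}^n:\mu_f(\partial K\cap\overline{[x,K]\setminus K})\le s\}.$$ (The values of $f$ at the four points of $\partial B_2^2$ on the coordinate axes are irrelevant.) *)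

theory Defs
  imports "HOL-Analysis.Analysis"
begin

text \<open>
  The boundary surface measure of a convex body in an \<open>n\<close>-dimensional Euclidean space is
  the \<open>(n - 1)\<close>-dimensional Hausdorff measure on its boundary. The normalising factor
  \<open>unit_ball_vol d / 2 ^ d\<close> is the usual one for which Hausdorff measure is surface area
  (for \<open>d = 1\<close> it equals 1, and one gets arc length). Covering sets are required to be
  bounded because \<^const>\<open>diameter\<close> is unspecified on unbounded sets, and the empty set is
  treated separately because of \<open>0 ^ 0 = 1\<close> in the case \<open>d = 0\<close>.
\<close>

definition hausdorff_premeasure :: "nat \<Rightarrow> real \<Rightarrow> 'a::metric_space set \<Rightarrow> ennreal" where
  "hausdorff_premeasure d \<delta> A =
     (INF C \<in> {C :: nat \<Rightarrow> 'a set.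
                 A \<subseteq> (\<Union>i. C i) \<and> (\<forall>i. bounded (C i) \<and> diameter (C i) \<le> \<delta>)}.
        \<Sum>i. if C i = {} then 0
             else ennreal (unit_ball_vol (real d) * (diameter (C i) / 2) ^ d))"

definition hausdorff_outer :: "nat \<Rightarrow> 'a::metric_space set \<Rightarrow> ennreal" where
  "hausdorff_outer d A = (SUP \<delta>\<in>{0<..}. hausdorff_premeasure d \<delta> A)"

text \<open>Realised as a Borel measure on the whole space that is concentrated on the boundary.\<close>

definition surface_measure :: "'a::euclidean_space set \<Rightarrow> 'a measure" where
  "surface_measure K =
     measure_of UNIV (sets borel) (\<lambda>A. hausdorff_outer (DIM('a) - 1) (A \<inter> frontier K))"

text \<open>
  Functions on the boundary are represented by functions on the whole space; only their values
  on \<open>frontier K\<close> matter below.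
\<close>

definition illumination_surface_body ::
    "'a::euclidean_space set \<Rightarrow> ('a \<Rightarrow> real) \<Rightarrow> real \<Rightarrow> 'a set" where
  "illumination_surface_body K f s =
     {x. (LINT y : frontier K \<inter> closure (convex hull (insert x K) - K) | surface_measure K. f y) \<le> s}"

text \<open>
  \<open>C_n_on n U g\<close> for open \<open>U\<close>: all iterated directional derivatives of \<open>g\<close> of order at most
  \<open>n\<close> exist and are continuous on \<open>U\<close>.
\<close>

primrec C_n_on ::
    "nat \<Rightarrow> 'a::real_normed_vector set \<Rightarrow> ('a \<Rightarrow> 'b::real_normed_vector) \<Rightarrow> bool" where
  "C_n_on 0 U g \<longleftrightarrow> continuous_on U g"
| "C_n_on (Suc n) U g \<longleftrightarrow>
     (\<forall>x\<in>U. g differentiable (at x)) \<and>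
     (\<forall>v. C_n_on n U (\<lambda>x. frechet_derivative g (at x) v))"

text \<open>
  A function on a subset \<open>S\<close> of a normed space (here: on the unit circle) is smooth if it is the
  restriction of a \<open>C\<^sup>\<infinity>\<close> function on an open neighbourhood of \<open>S\<close>.
\<close>

definition smooth_function_on ::
    "'a::real_normed_vector set \<Rightarrow> ('a \<Rightarrow> 'b::real_normed_vector) \<Rightarrow> bool" where
  "smooth_function_on S f \<longleftrightarrow>
     (\<exists>U g. open U \<and> S \<subseteq> U \<and> (\<forall>n. C_n_on n U g) \<and> (\<forall>x\<in>S. g x = f x))"

end

(*
  A point x outside the disc lights the arc between the two tangents through x, so x belongs to
  the body iff this arc has f-mass at most s. If the mass stays equal to s while the contact points
  a < b move, x moves in the direction f(a) u(a) + f(b) u(b), where u(t) is the unit tangent at t.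
  When a passes from the fourth into the first quadrant, f(a) jumps up by a factor 4 and this
  direction turns clockwise, so the boundary of the body has a reentrant corner at the point of the
  line x = 1 with b = pi/16. For a smooth density, 1 - cos t (the restriction of an affine function)
  already varies fast enough near its zero at t = 0.
*)
theory Submission
  imports Defs
begin

subsection \<open>One-dimensional Hausdorff measure on the circle\<close>

text \<open>Reason for the direction rule: sliding x along the tangent at a fixes a and moves b, and
  vice versa. The two tangent segments have equal length, so a displacement p u(a) + q u(b) moves a
  and b at rates proportional to q and p; then f(a) da = f(b) db forces p : q = f(a) : f(b). For the
  density 1 - cos t and the arc from a = 0 to b = pi/2, constant mass makes b - pi/2 of order a^3/6,
  so the clockwise turn of order a^2/2 due to f(a) beats the counterclockwise turn of u(b). Neither
  boundary curve is constructed: two explicit points of the body and one point of the segment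
  between them suffice. The obstacle is that the measure is given by Hausdorff covers, so it must
  first be identified with the image of Lebesgue measure under the angle map.\<close>

lemma interior_closed_interval_length:
  fixes c d :: real
  assumes "interior (cbox c d) \<noteq> {}"
  shows "c < d" "emeasure lborel (interior (cbox c d)) = ennreal (d - c)"
proof -
  show "c < d" using assms by (auto simp: interior_cbox box_real)
  then show "emeasure lborel (interior (cbox c d)) = ennreal (d - c)"
    by (simp add: interior_cbox box_real)
qed

lemma diameter_1_lipschitz_image_le:
  fixes \<gamma> :: "real \<Rightarrow> 'a::real_normed_vector"
  assumes lip: "\<And>x y. dist (\<gamma> x) (\<gamma> y) \<le> \<bar>x - y\<bar>" and "0 \<le> r"
    and "\<And>x y. x \<in> S \<Longrightarrow> y \<in> S \<Longrightarrow> \<bar>x - y\<bar> \<le> r"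
  shows "bounded (\<gamma> ` S)" "diameter (\<gamma> ` S) \<le> r"
proof -
  have d: "dist u v \<le> r" if "u \<in> \<gamma> ` S" "v \<in> \<gamma> ` S" for u v
    using that assms(3) order_trans[OF lip] by blast
  show "bounded (\<gamma> ` S)"
    unfolding bounded_two_points using d by blast
  show "diameter (\<gamma> ` S) \<le> r"
    by (rule diameter_le) (use d \<open>0 \<le> r\<close> in \<open>auto simp: dist_norm\<close>)
qed

lemma hausdorff_premeasure_le:
  assumes "A \<subseteq> (\<Union>i. C i)" "\<And>i. bounded (C i)" "\<And>i. diameter (C i) \<le> \<delta>"
  shows "hausdorff_premeasure 1 \<delta> A \<le> (\<Sum>i. if C i = {} then 0 else ennreal (diameter (C i)))"
proof -
  have "hausdorff_premeasure 1 \<delta> A \<le> (\<Sum>i. if C i = {} then 0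
     else ennreal (unit_ball_vol (real 1) * (diameter (C i) / 2) ^ 1))"
    unfolding hausdorff_premeasure_def
    by (rule INF_lower) (use assms in auto)
  also have "\<dots> = (\<Sum>i. if C i = {} then 0 else ennreal (diameter (C i)))"
    by (intro suminf_cong) (auto simp: unit_ball_vol_1)
  finally show ?thesis .
qed

text \<open>Intervals of length at most \<open>\<delta>\<close> that cover \<open>B\<close> with
  total length at most \<open>emeasure lborel B + \<epsilon>\<close> map to an admissible cover of
  no larger total diameter.\<close>

lemma hausdorff_outer_1_lipschitz_image_le:
  fixes \<gamma> :: "real \<Rightarrow> 'a::real_normed_vector"
  assumes lip: "\<And>x y. dist (\<gamma> x) (\<gamma> y) \<le> \<bar>x - y\<bar>"
    and B: "B \<in> sets borel" "B \<subseteq> {a..b}" and "a < b"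
  shows "hausdorff_outer 1 (\<gamma> ` B) \<le> emeasure lborel B"
  unfolding hausdorff_outer_def
proof (rule SUP_least)
  fix \<delta> :: real assume "\<delta> \<in> {0<..}"
  then have \<delta>: "0 < \<delta>" by simp
  show "hausdorff_premeasure 1 \<delta> (\<gamma> ` B) \<le> emeasure lborel B"
  proof (rule ennreal_le_epsilon)
    fix \<epsilon> :: real assume \<epsilon>: "0 < \<epsilon>"
    obtain U where U: "open U" "B \<subseteq> U" "emeasure lborel (U - B) < \<epsilon>"
      using outer_regular_lborel[OF B(1) \<epsilon>] by blast
    \<comment> \<open>This gauge keeps each interval inside \<open>U\<close> and within
      \<open>\<delta> / 2\<close> of its tag, hence of length at most \<open>\<delta>\<close>; the
      second branch is there because a gauge is defined at every point.\<close>
    define g where "g x = (if x \<in> U then U \<inter> ball x (\<delta> / 2) else ball x (\<delta> / 2))" for x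
    have sub: "B \<subseteq> cbox a b" "box a b \<noteq> {}" using B \<open>a < b\<close> by (auto simp: box_real)
    have "gauge g" using U \<delta> by (auto simp: gauge_def g_def)
    have "\<exists>\<D>. countable \<D> \<and> B \<subseteq> \<Union>\<D> \<and> (\<forall>K\<in>\<D>. interior K \<noteq> {}) \<and> (\<forall>K\<in>\<D>. \<exists>c d. K = cbox c d)
        \<and> pairwise (\<lambda>A B. interior A \<inter> interior B = {}) \<D> \<and> (\<forall>K\<in>\<D>. \<exists>x \<in> B \<inter> K. K \<subseteq> g x)"
    proof (rule covering_lemma[OF sub \<open>gauge g\<close>])
      fix \<D>
      assume D: "countable \<D>" "B \<subseteq> \<Union>\<D>" "pairwise (\<lambda>A B. interior A \<inter> interior B = {}) \<D>"
        and K: "\<And>K. K \<in> \<D> \<Longrightarrow> interior K \<noteq> {} \<and> (\<exists>c d. K = cbox c d)"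
        and x: "\<And>K. K \<in> \<D> \<Longrightarrow> \<exists>x \<in> B \<inter> K. K \<subseteq> g x"
      show ?thesis
        by (intro exI[of _ \<D>] conjI ballI D) (use K x in simp_all)
    qed
    then obtain \<D> where \<D>: "countable \<D>" "B \<subseteq> \<Union>\<D>"
        "\<forall>K\<in>\<D>. interior K \<noteq> {}" "\<forall>K\<in>\<D>. \<exists>c d. K = cbox c d"
        "pairwise (\<lambda>A B. interior A \<inter> interior B = {}) \<D>"
        "\<forall>K\<in>\<D>. \<exists>x \<in> B \<inter> K. K \<subseteq> g x"
      by (elim exE conjE)
    \<comment> \<open>The family may be finite; indices outside \<open>N\<close> get the empty set,
      which the premeasure counts as 0.\<close>
    define N where "N = to_nat_on \<D> ` \<D>"
    define K where "K i = from_nat_into \<D> i" for i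
    have K: "K i \<in> \<D>" if "i \<in> N" for i
      using that \<D>(1) by (auto simp: N_def K_def)
    have Kinj: "K i \<noteq> K j" if "i \<in> N" "j \<in> N" "i \<noteq> j" for i j
      using that \<D>(1) by (auto simp: N_def K_def)
    define C where "C i = (if i \<in> N then \<gamma> ` K i else {})" for i
    \<comment> \<open>The closed intervals may share endpoints, but their interiors are disjoint and
      equally long, so the lengths add up to at most the measure of \<open>U\<close>.\<close>
    define J where "J i = (if i \<in> N then interior (K i) else {})" for i
    have cover: "\<gamma> ` B \<subseteq> (\<Union>i. C i)"
    proof
      fix y assume "y \<in> \<gamma> ` B"
      then obtain x D where xD: "y = \<gamma> x" "x \<in> D" "D \<in> \<D>" using \<D>(2) by auto
      then have "to_nat_on \<D> D \<in> N" "K (to_nat_on \<D> D) = D"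
        using \<D>(1) by (auto simp: N_def K_def)
      with xD show "y \<in> (\<Union>i. C i)"
        by (auto simp: C_def intro!: exI[of _ "to_nat_on \<D> D"])
    qed
    have piece: "bounded (C i) \<and> diameter (C i) \<le> \<delta> \<and> J i \<subseteq> U
        \<and> (if C i = {} then 0 else ennreal (diameter (C i))) \<le> emeasure lborel (J i)" for i
    proof (cases "i \<in> N")
      case True
      obtain c d where cd: "K i = cbox c d" using \<D>(4) K[OF True] by blast
      have ne: "interior (cbox c d) \<noteq> {}" using \<D>(3) K[OF True] cd by auto
      note cd' = interior_closed_interval_length[OF ne]
      obtain x where x: "x \<in> B" "K i \<subseteq> g x" using \<D>(6) K[OF True] by auto
      have "x \<in> U" using x U by auto
      then have g: "K i \<subseteq> U" "K i \<subseteq> ball x (\<delta> / 2)" using x(2) by (auto simp: g_def)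
      have "c \<in> K i" "d \<in> K i" using cd cd' by auto
      then have "dist x c < \<delta> / 2" "dist x d < \<delta> / 2" using g(2) by auto
      then have "d - c \<le> \<delta>" unfolding dist_real_def by linarith
      moreover have "\<bar>x - y\<bar> \<le> d - c" if "x \<in> K i" "y \<in> K i" for x y
        using that cd by auto
      then have "bounded (\<gamma> ` K i)" "diameter (\<gamma> ` K i) \<le> d - c"
        using diameter_1_lipschitz_image_le[where \<gamma> = \<gamma> and r = "d - c" and S = "K i", OF lip] cd cd'(1)
        by auto
      moreover have "J i \<subseteq> U" using g True interior_subset by (auto simp: J_def)
      moreover have "emeasure lborel (J i) = ennreal (d - c)" using True cd cd' by (simp add: J_def)
      ultimately show ?thesis using True
        by (auto simp: C_def intro: ennreal_leI)
    qed (use \<delta> in \<open>auto simp: C_def J_def\<close>)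
    have "hausdorff_premeasure 1 \<delta> (\<gamma> ` B)
        \<le> (\<Sum>i. if C i = {} then 0 else ennreal (diameter (C i)))"
      using cover piece by (intro hausdorff_premeasure_le) auto
    also have "\<dots> \<le> (\<Sum>i. emeasure lborel (J i))"
      using piece by (intro suminf_le) auto
    also have "\<dots> = emeasure lborel (\<Union>i. J i)"
    proof (rule suminf_emeasure)
      show "range J \<subseteq> sets lborel" by (auto simp: J_def)
      show "disjoint_family J"
        using \<D>(5) K Kinj unfolding disjoint_family_on_def pairwise_def J_def by simp
    qed
    also have "\<dots> \<le> emeasure lborel U"
      using U piece by (intro emeasure_mono) auto
    also have "\<dots> \<le> emeasure lborel (U - B) + emeasure lborel B"
      using emeasure_subadditive[of "U - B" lborel B] U B by (simp add: Un_absorb2 sets.Diff)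
    also have "\<dots> \<le> emeasure lborel B + ennreal \<epsilon>"
      using U(3) by (simp add: add.commute add_left_mono less_imp_le)
    finally show "hausdorff_premeasure 1 \<delta> (\<gamma> ` B) \<le> emeasure lborel B + ennreal \<epsilon>" .
  qed
qed

lemma interval_hull_of_small_set:
  fixes X :: "real set"
  assumes "0 \<le> r" and "\<And>x y. x \<in> X \<Longrightarrow> y \<in> X \<Longrightarrow> \<bar>x - y\<bar> \<le> r"
  obtains u v where "X \<subseteq> {u..v}" "u \<le> v" "v - u \<le> r"
proof (cases "X = {}")
  case True
  then show ?thesis using that[of 0 0] \<open>0 \<le> r\<close> by auto
next
  case False
  then obtain p where p: "p \<in> X" by auto
  have "bdd_below X" "bdd_above X"
    using assms(2)[OF p] by (auto intro!: bdd_belowI[of _ "p - r"] bdd_aboveI[of _ "p + r"] simp: abs_le_iff; smt (verit))+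
  moreover have "Sup X - Inf X \<le> r"
  proof -
    have "Sup X \<le> x + r" if "x \<in> X" for x
      using that assms(2)[of _ x] False by (intro cSup_least) (auto simp: abs_le_iff, smt (verit))
    then have "Sup X - r \<le> Inf X"
      using False by (intro cInf_greatest) (auto simp: algebra_simps)
    then show ?thesis by simp
  qed
  ultimately show ?thesis
    using that[of "Inf X" "Sup X"] p by (smt (verit) atLeastAtMost_iff cInf_lower cSup_upper subsetI)
qed

section \<open>Angles and chords of the unit circle\<close>

definition circle_pt :: "real \<Rightarrow> real ^ 2" where
  "circle_pt t = vector [cos t, sin t]"

lemma circle_pt_nth [simp]: "circle_pt t $ 1 = cos t" "circle_pt t $ 2 = sin t"
  by (simp_all add: circle_pt_def)

lemma inner_real2: "(x :: real ^ 2) \<bullet> y = x $ 1 * y $ 1 + x $ 2 * y $ 2"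
  by (simp add: inner_vec_def sum_2)

lemma norm_real2_sq: "(norm (x :: real ^ 2))\<^sup>2 = (x $ 1)\<^sup>2 + (x $ 2)\<^sup>2"
  by (simp only: power2_norm_eq_inner inner_real2) (simp add: power2_eq_square)

lemma norm_circle_pt [simp]: "norm (circle_pt t) = 1"
  using norm_real2_sq[of "circle_pt t"] by (simp add: power2_eq_1_iff) (smt (verit) norm_ge_zero)

lemma dist_circle_pt: "dist (circle_pt a) (circle_pt b) = 2 * \<bar>sin ((a - b) / 2)\<bar>"
proof (rule power2_eq_imp_eq)
  have "(dist (circle_pt a) (circle_pt b))\<^sup>2 = (cos a - cos b)\<^sup>2 + (sin a - sin b)\<^sup>2"
    by (simp add: dist_norm norm_real2_sq)
  also have "\<dots> = 2 - 2 * cos (a - b)"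
    using sin_cos_squared_add[of a] sin_cos_squared_add[of b]
    by (simp add: cos_diff power2_eq_square algebra_simps)
  also have "\<dots> = 2 - 2 * cos (2 * ((a - b) / 2))" by (simp only: nonzero_mult_div_cancel_left times_divide_eq_right)
  also have "\<dots> = (2 * \<bar>sin ((a - b) / 2)\<bar>)\<^sup>2"
    by (simp only: cos_double_sin power_mult_distrib power2_abs) simp
  finally show "(dist (circle_pt a) (circle_pt b))\<^sup>2 = (2 * \<bar>sin ((a - b) / 2)\<bar>)\<^sup>2" .
qed auto

lemma dist_circle_pt_le: "dist (circle_pt a) (circle_pt b) \<le> \<bar>a - b\<bar>"
  using abs_sin_x_le_abs_x[of "(a - b) / 2"] by (simp add: dist_circle_pt)

lemma continuous_on_circle_pt [continuous_intros]: "continuous_on S circle_pt"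
  unfolding continuous_on_iff
  by (metis dist_circle_pt_le dist_real_def le_less_trans)

lemma measurable_circle_pt [measurable]: "circle_pt \<in> borel_measurable borel"
  by (intro borel_measurable_continuous_onI continuous_on_circle_pt)

lemma circle_pt_surj:
  assumes "norm x = 1"
  obtains t where "t \<in> {-pi<..pi}" "x = circle_pt t"
proof -
  have "(x $ 1)\<^sup>2 + (x $ 2)\<^sup>2 = 1" using norm_real2_sq[of x] assms by simp
  then obtain t' where t': "x $ 1 = cos t'" "x $ 2 = sin t'" using sincos_total_2pi by metis
  obtain t where "- pi < t" "t \<le> pi" "sin t = sin t'" "cos t = cos t'"
    using sincos_principal_value by blast
  with t' show ?thesis by (intro that[of t]) (auto simp: vec_eq_iff forall_2)
qed

lemma circle_pt_inj: "inj_on circle_pt {-pi<..pi}"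
proof (rule inj_onI)
  fix a b assume ab: "a \<in> {-pi<..pi}" "b \<in> {-pi<..pi}" "circle_pt a = circle_pt b"
  then have "sin ((a - b) / 2) = 0" using dist_circle_pt[of a b] by simp
  moreover have "- pi < (a - b) / 2" "(a - b) / 2 < pi" using ab by auto
  ultimately have "(a - b) / 2 = 0" by (metis sin_eq_0_pi)
  then show "a = b" by simp
qed

text \<open>Away from the branch point of the angle, short chords determine short angle differences.\<close>

lemma angle_le_chord:
  assumes "0 < \<eta>" "\<eta> < pi / 2" "a \<in> {-pi+\<eta>..pi-\<eta>}" "b \<in> {-pi+\<eta>..pi-\<eta>}"
    and "dist (circle_pt a) (circle_pt b) \<le> sin \<eta>"
  shows "\<bar>a - b\<bar> \<le> dist (circle_pt a) (circle_pt b) / cos \<eta>"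
proof -
  define u where "u = \<bar>a - b\<bar> / 2"
  have u: "0 \<le> u" "u \<le> pi - \<eta>" using assms by (auto simp: u_def)
  have "0 \<le> sin u" using u assms by (intro sin_ge_zero) auto
  have "\<bar>sin ((a - b) / 2)\<bar> = sin u"
    using \<open>0 \<le> sin u\<close> by (cases "a \<le> b") (auto simp: u_def abs_real_def minus_diff_eq[of a b, symmetric] simp del: minus_diff_eq)
  then have d: "dist (circle_pt a) (circle_pt b) = 2 * sin u" by (simp add: dist_circle_pt)
  have s0: "0 < sin \<eta>" "0 < cos \<eta>" using assms by (auto intro: sin_gt_zero cos_gt_zero)
  \<comment> \<open>Otherwise \<open>u\<close> lies between \<open>\<eta>\<close> and
    \<open>pi - \<eta>\<close>, and the chord \<open>2 * sin u\<close> would be at least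
    \<open>2 * sin \<eta>\<close>, above the assumed bound \<open>sin \<eta>\<close>.\<close>
  have "u < \<eta>"
  proof (rule ccontr)
    assume "\<not> u < \<eta>"
    have "sin \<eta> \<le> sin u"
    proof (cases "u \<le> pi / 2")
      case True
      then show ?thesis using assms \<open>\<not> u < \<eta>\<close> by (intro sin_monotone_2pi_le) auto
    next
      case False
      then have "sin \<eta> \<le> sin (pi - u)" using assms u by (intro sin_monotone_2pi_le) auto
      then show ?thesis by simp
    qed
    then show False using assms(5) d s0 by simp
  qed
  have "u * cos \<eta> \<le> u * cos u"
    using u \<open>u < \<eta>\<close> assms by (intro mult_left_mono cos_monotone_0_pi_le) auto
  also have "\<dots> \<le> sin u"
    using abs_tan_ge[of u] \<open>u < \<eta>\<close> u assms \<open>0 \<le> sin u\<close> cos_gt_zero_pi[of u]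
    by (simp add: tan_def field_simps)
  finally show ?thesis using d s0 by (simp add: u_def field_simps)
qed

text \<open>Cutting off length \<open>\<eta>\<close> at each end of the angle range, where the angle
  jumps, costs \<open>2 * \<eta>\<close>. On the rest, by \<open>angle_le_chord\<close>, the angles
  sent into \<open>C i\<close> fit into an interval of length
  \<open>diameter (C i) / cos \<eta>\<close>.\<close>

lemma arc_measure_le_of_cover:
  fixes C :: "nat \<Rightarrow> (real ^ 2) set"
  assumes \<eta>: "0 < \<eta>" "\<eta> < pi / 2" and B: "B \<in> sets borel" "B \<subseteq> {-pi<..pi}"
    and cover: "circle_pt ` B \<subseteq> (\<Union>i. C i)"
    and C: "\<And>i. bounded (C i)" "\<And>i. diameter (C i) \<le> sin \<eta>"
  shows "ennreal (cos \<eta>) * emeasure lborel B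
    \<le> ennreal (2 * \<eta>) + (\<Sum>i. if C i = {} then 0 else ennreal (diameter (C i)))"
proof -
  define D where "D i = (if C i = {} then 0 else diameter (C i))" for i
  have c0: "0 < cos \<eta>" using \<eta> by (intro cos_gt_zero) auto
  have D0: "0 \<le> D i" for i using C(1)[of i] by (auto simp: D_def diameter_ge_0)
  define X where "X i = {t \<in> {-pi+\<eta>..pi-\<eta>}. circle_pt t \<in> C i}" for i
  have "\<exists>J. X i \<subseteq> J \<and> J \<in> sets lborel \<and> emeasure lborel J \<le> ennreal (D i / cos \<eta>)" for i
  proof -
    have *: "\<bar>a - b\<bar> \<le> D i / cos \<eta>" if "a \<in> X i" "b \<in> X i" for a b
    proof -
      have ab: "circle_pt a \<in> C i" "circle_pt b \<in> C i" using that by (auto simp: X_def)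
      then have le: "dist (circle_pt a) (circle_pt b) \<le> D i"
        using diameter_bounded_bound[OF C(1)[of i] ab] by (auto simp: D_def)
      then have "\<bar>a - b\<bar> \<le> dist (circle_pt a) (circle_pt b) / cos \<eta>"
        using that C(2)[of i] ab \<eta> by (intro angle_le_chord) (auto simp: X_def D_def split: if_splits)
      also have "\<dots> \<le> D i / cos \<eta>" using le c0 by (simp add: divide_right_mono)
      finally show ?thesis .
    qed
    obtain u v where "X i \<subseteq> {u..v}" "u \<le> v" "v - u \<le> D i / cos \<eta>"
      using interval_hull_of_small_set[of "D i / cos \<eta>" "X i"] * D0[of i] c0
      by (metis divide_nonneg_pos)
    then show ?thesis by (intro exI[of _ "{u..v}"]) (auto intro: ennreal_leI)
  qed
  then obtain J where J: "\<And>i. X i \<subseteq> J i" "\<And>i. J i \<in> sets lborel"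
      "\<And>i. emeasure lborel (J i) \<le> ennreal (D i / cos \<eta>)"
    by metis
  let ?E = "{-pi..-pi+\<eta>} \<union> {pi-\<eta>..pi}"
  have sub: "B \<subseteq> ?E \<union> (\<Union>i. J i)"
  proof
    fix t assume t: "t \<in> B"
    then obtain i where "circle_pt t \<in> C i" using cover by auto
    then have "t \<in> ?E \<or> t \<in> X i" using t B(2) by (auto simp: X_def)
    then show "t \<in> ?E \<union> (\<Union>i. J i)" using J(1) by blast
  qed
  have "emeasure lborel B \<le> emeasure lborel (?E \<union> (\<Union>i. J i))"
    using sub J(2) by (intro emeasure_mono) auto
  also have "\<dots> \<le> emeasure lborel ?E + emeasure lborel (\<Union>i. J i)"
    using J(2) by (intro emeasure_subadditive) auto
  also have "\<dots> \<le> ennreal (2 * \<eta>) + (\<Sum>i. ennreal (D i / cos \<eta>))"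
  proof (rule add_mono)
    have "emeasure lborel ?E \<le> emeasure lborel {-pi..-pi+\<eta>} + emeasure lborel {pi-\<eta>..pi}"
      by (intro emeasure_subadditive) auto
    also have "\<dots> = ennreal (2 * \<eta>)" using \<eta> by (simp flip: ennreal_plus)
    finally show "emeasure lborel ?E \<le> ennreal (2 * \<eta>)" .
    have "emeasure lborel (\<Union>i. J i) \<le> (\<Sum>i. emeasure lborel (J i))"
      using J(2) by (intro emeasure_subadditive_countably) auto
    also have "\<dots> \<le> (\<Sum>i. ennreal (D i / cos \<eta>))" using J(3) by (intro suminf_le) auto
    finally show "emeasure lborel (\<Union>i. J i) \<le> (\<Sum>i. ennreal (D i / cos \<eta>))" .
  qed
  finally have "ennreal (cos \<eta>) * emeasure lborel B
      \<le> ennreal (cos \<eta>) * (ennreal (2 * \<eta>) + (\<Sum>i. ennreal (D i / cos \<eta>)))"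
    by (rule mult_left_mono) simp
  also have "\<dots> = ennreal (cos \<eta>) * ennreal (2 * \<eta>) + (\<Sum>i. ennreal (cos \<eta>) * ennreal (D i / cos \<eta>))"
    by (simp add: distrib_left ennreal_suminf_cmult)
  also have "\<dots> = ennreal (cos \<eta>) * ennreal (2 * \<eta>) + (\<Sum>i. if C i = {} then 0 else ennreal (diameter (C i)))"
    using c0 D0 by (intro arg_cong2[of _ _ _ _ "(+)"] suminf_cong refl)
      (auto simp: D_def simp flip: ennreal_mult)
  also have "ennreal (cos \<eta>) * ennreal (2 * \<eta>) \<le> ennreal (2 * \<eta>)"
    using \<eta> c0 by (auto simp flip: ennreal_mult intro!: ennreal_leI mult_left_le_one_le)
  finally show ?thesis by (simp add: add_right_mono)
qed

text \<open>Covers at scale \<open>sin \<eta>\<close> give the bound up to a factor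
  \<open>cos \<eta>\<close> and an error \<open>2 * \<eta>\<close>, which disappear as
  \<open>\<eta>\<close> tends to 0.\<close>

lemma hausdorff_outer_1_circle_ge:
  assumes B: "B \<in> sets borel" "B \<subseteq> {-pi<..pi}"
  shows "emeasure lborel B \<le> hausdorff_outer 1 (circle_pt ` B)"
proof -
  let ?H = "hausdorff_outer 1 (circle_pt ` B)"
  have fin: "emeasure lborel B < \<infinity>"
  proof -
    have "emeasure lborel B \<le> emeasure lborel {-pi..pi}" using B by (intro emeasure_mono) auto
    also have "\<dots> < \<infinity>" by simp
    finally show ?thesis .
  qed
  have *: "ennreal (cos \<eta>) * emeasure lborel B \<le> ennreal (2 * \<eta>) + ?H"
    if \<eta>: "0 < \<eta>" "\<eta> < pi / 2" for \<eta>
  proof -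
    have "0 < sin \<eta>" using \<eta> by (intro sin_gt_zero) auto
    have "ennreal (cos \<eta>) * emeasure lborel B - ennreal (2 * \<eta>)
        \<le> hausdorff_premeasure 1 (sin \<eta>) (circle_pt ` B)"
      unfolding hausdorff_premeasure_def
    proof (rule INF_greatest, clarify)
      fix C :: "nat \<Rightarrow> (real ^ 2) set"
      assume C: "circle_pt ` B \<subseteq> (\<Union>i. C i)" "\<forall>i. bounded (C i) \<and> diameter (C i) \<le> sin \<eta>"
      then have "ennreal (cos \<eta>) * emeasure lborel B
        \<le> ennreal (2 * \<eta>) + (\<Sum>i. if C i = {} then 0 else ennreal (diameter (C i)))"
        using \<eta> B by (intro arc_measure_le_of_cover) auto
      also have "(\<Sum>i. if C i = {} then 0 else ennreal (diameter (C i)))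
        = (\<Sum>i. if C i = {} then 0
             else ennreal (unit_ball_vol (real 1) * (diameter (C i) / 2) ^ 1))"
        by (intro suminf_cong) (auto simp: unit_ball_vol_1)
      finally show "ennreal (cos \<eta>) * emeasure lborel B - ennreal (2 * \<eta>) \<le>
          (\<Sum>i. if C i = {} then 0
             else ennreal (unit_ball_vol (real 1) * (diameter (C i) / 2) ^ 1))"
        by (auto simp: ennreal_minus_le_iff)
    qed
    also have "\<dots> \<le> ?H"
      unfolding hausdorff_outer_def using \<open>0 < sin \<eta>\<close> by (intro SUP_upper) auto
    finally show ?thesis by (simp add: ennreal_minus_le_iff)
  qed
  show ?thesis
  proof (cases "?H = \<infinity>")
    case False
    then obtain h where h: "?H = ennreal h" "0 \<le> h" by (cases ?H) auto
    obtain l where l: "emeasure lborel B = ennreal l" "0 \<le> l" using fin by (cases "emeasure lborel B") auto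
    have le: "cos \<eta> * l \<le> 2 * \<eta> + h" if "0 < \<eta>" "\<eta> < pi / 2" for \<eta>
    proof -
      have "0 < cos \<eta>" using that by (intro cos_gt_zero) auto
      then show ?thesis using *[OF that] h l that
        by (simp flip: ennreal_mult ennreal_plus)
    qed
    have "l \<le> h"
    proof (rule tendsto_le)
      show "((\<lambda>\<eta>. cos \<eta> * l) \<longlongrightarrow> l) (at_right 0)" 
        by (auto intro!: tendsto_eq_intros)
      show "((\<lambda>\<eta>. 2 * \<eta> + h) \<longlongrightarrow> h) (at_right 0)" 
        by (auto intro!: tendsto_eq_intros)
      show "\<forall>\<^sub>F \<eta> in at_right 0. cos \<eta> * l \<le> 2 * \<eta> + h"
        using le by (auto simp: eventually_at_right_field intro!: exI[of _ "pi/2"])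
    qed simp
    then show ?thesis using h l by (simp add: ennreal_leI)
  qed simp
qed

text \<open>\<open>measure_of\<close> keeps the given values only if they form a measure. On Borel
  sets the Hausdorff outer measure agrees with an image of Lebesgue measure, so countable additivity
  is inherited and no Caratheodory argument is used. The half-open interval gives each point of the
  circle exactly one angle.\<close>

lemma surface_measure_disc:
  "surface_measure (cball 0 1 :: (real ^ 2) set)
    = distr (restrict_space lborel {-pi<..pi}) borel circle_pt" (is "_ = ?M")
proof -
  have [measurable]: "circle_pt \<in> restrict_space lborel {-pi<..pi} \<rightarrow>\<^sub>M borel"
    by (intro measurable_restrict_space1) simp
  have "hausdorff_outer (DIM(real ^ 2) - 1) (A \<inter> frontier (cball 0 1)) = emeasure ?M A"
    if A: "A \<in> sets borel" for A :: "(real ^ 2) set"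
  proof -
    define B where "B = circle_pt -` A \<inter> {-pi<..pi}"
    have B: "B \<in> sets borel" using A measurable_sets_borel[OF measurable_circle_pt A] by (simp add: B_def)
    have img: "A \<inter> frontier (cball 0 1) = circle_pt ` B"
      by (auto simp: B_def elim!: circle_pt_surj)
    have "hausdorff_outer 1 (circle_pt ` B) = emeasure lborel B"
    proof (rule antisym)
      show "hausdorff_outer 1 (circle_pt ` B) \<le> emeasure lborel B"
        by (rule hausdorff_outer_1_lipschitz_image_le[where a = "-pi" and b = pi])
          (use B in \<open>auto simp: B_def dist_circle_pt_le\<close>)
      show "emeasure lborel B \<le> hausdorff_outer 1 (circle_pt ` B)"
        by (rule hausdorff_outer_1_circle_ge) (use B in \<open>auto simp: B_def\<close>)
    qed
    also have "\<dots> = emeasure ?M A"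
      using A B by (simp add: emeasure_distr emeasure_restrict_space space_restrict_space B_def Int_commute)
    finally show ?thesis unfolding img by simp
  qed
  then have "surface_measure (cball 0 1 :: (real ^ 2) set) = measure_of UNIV (sets borel) (emeasure ?M)"
    unfolding surface_measure_def
    by (intro measure_of_eq) (simp_all add: sets.sigma_sets_eq[of borel, simplified])
  also have "\<dots> = ?M" using measure_of_of_measure[of ?M] by simp
  finally show ?thesis .
qed

subsection \<open>Illuminated arcs\<close>

text \<open>If \<open>z = u x + v k\<close> is a hull point outside the ball, with \<open>k\<close>
  in the ball, then z.z = u (z.x) + v (z.k) <= u (z.x) + v (z.z), hence 1 < z.z <= z.x; this bound
  survives closure. Conversely, the segment from such a \<open>y\<close> to \<open>x\<close> leaves
  the ball at once.\<close>

lemma illuminated_part_of_sphere: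
  fixes x :: "'a::euclidean_space"
  assumes x: "1 < norm x"
  shows "frontier (cball 0 1) \<inter> closure (convex hull (insert x (cball 0 1)) - cball 0 1)
    = {y. norm y = 1 \<and> 1 \<le> y \<bullet> x}"
proof (intro equalityI subsetI)
  fix y assume "y \<in> frontier (cball 0 1) \<inter> closure (convex hull (insert x (cball 0 1)) - cball 0 1)"
  then have y: "norm y = 1" "y \<in> closure (convex hull (insert x (cball 0 1)) - cball 0 1)"
    by auto
  have "convex hull (insert x (cball 0 1)) - cball 0 1 \<subseteq> {z. 1 \<le> z \<bullet> x}"
  proof
    fix z assume "z \<in> convex hull (insert x (cball 0 1)) - cball 0 1"
    then have "z \<in> convex hull (insert x (cball 0 1))" and "1 < norm z" by auto
    then obtain u v k where z: "1 < norm z" "0 \<le> u" "0 \<le> v" "u + v = 1"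
        "k \<in> cball 0 1" "z = u *\<^sub>R x + v *\<^sub>R k"
      by (auto simp: convex_hull_insert convex_hull_eq[THEN iffD2])
    have v: "v * norm k \<le> v" using z by (simp add: mult_left_le)
    have "1 < (norm z)\<^sup>2" using z(1) by (simp add: power2_eq_square less_1_mult)
    then have zz: "1 < z \<bullet> z" by (simp add: power2_norm_eq_inner)
    have "z \<bullet> z = u * (z \<bullet> x) + v * (z \<bullet> k)"
      by (subst (2) z(6)) (simp add: inner_add_right)
    moreover have "v * (z \<bullet> k) \<le> v * norm z"
    proof (rule mult_left_mono)
      have "z \<bullet> k \<le> norm z * norm k" by (rule norm_cauchy_schwarz)
      also have "\<dots> \<le> norm z" using z by (simp add: mult_left_le)
      finally show "z \<bullet> k \<le> norm z" .
    qed (use z in auto)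
    moreover have "v * norm z \<le> v * (z \<bullet> z)"
    proof (rule mult_left_mono)
      show "norm z \<le> z \<bullet> z"
        using mult_left_mono[of 1 "norm z" "norm z"] z(1)
        by (simp add: power2_norm_eq_inner[symmetric] power2_eq_square)
    qed (rule z)
    ultimately have "(1 - v) * (z \<bullet> z) \<le> u * (z \<bullet> x)" by (simp add: algebra_simps)
    moreover have "u = 1 - v" using z(4) by simp
    ultimately have "u * (z \<bullet> z) \<le> u * (z \<bullet> x)" by simp
    moreover have "u \<noteq> 0" using z by auto
    ultimately have "z \<bullet> z \<le> z \<bullet> x" using z(2) by simp
    then show "z \<in> {z. 1 \<le> z \<bullet> x}" using zz by simp
  qed
  moreover have "closed {z. 1 \<le> z \<bullet> x}"
    by (intro closed_Collect_le continuous_intros)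
  ultimately have "y \<in> {z. 1 \<le> z \<bullet> x}" using y(2) closure_minimal by blast
  then show "y \<in> {y. norm y = 1 \<and> 1 \<le> y \<bullet> x}" using y by simp
next
  fix y assume "y \<in> {y. norm y = 1 \<and> 1 \<le> y \<bullet> x}"
  then have y: "norm y = 1" "1 \<le> y \<bullet> x" by auto
  have "x \<noteq> y" using x y by auto
  define p where "p n = y + inverse (real (Suc n)) *\<^sub>R (x - y)" for n
  have "p \<longlonglongrightarrow> y + 0 *\<^sub>R (x - y)"
    unfolding p_def by (intro tendsto_intros LIMSEQ_inverse_real_of_nat)
  moreover have "p n \<in> convex hull (insert x (cball 0 1)) - cball 0 1" for n
  proof -
    define e where "e = inverse (real (Suc n))"
    have e: "0 < e" "e \<le> 1" by (auto simp: e_def field_simps)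
    have pe: "p n = (1 - e) *\<^sub>R y + e *\<^sub>R x" by (simp add: p_def e_def algebra_simps)
    have hull: "p n \<in> convex hull (insert x (cball 0 1))"
      unfolding pe using y e
      by (intro convexD[OF convex_convex_hull]) (auto intro: hull_inc)
    have "(norm (p n))\<^sup>2 = 1 + 2 * e * (y \<bullet> x - 1) + e\<^sup>2 * (norm (x - y))\<^sup>2"
    proof -
      have "y \<bullet> y = 1" using y by (simp add: power2_norm_eq_inner[symmetric])
      then show ?thesis unfolding power2_norm_eq_inner pe
        by (simp add: inner_simps inner_commute[of x y] power2_eq_square algebra_simps)
    qed
    \<comment> \<open>This quadratic term decides the tangency case
      \<open>y \<bullet> x = 1\<close>, where the linear term vanishes.\<close>
    moreover have "0 < e\<^sup>2 * (norm (x - y))\<^sup>2" using e \<open>x \<noteq> y\<close> by simp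
    moreover have "0 \<le> 2 * e * (y \<bullet> x - 1)" using e y by simp
    ultimately have "1 < (norm (p n))\<^sup>2" by linarith
    then have "1 < norm (p n)" using power2_less_imp_less[of 1 "norm (p n)"] by simp
    with hull show ?thesis by simp
  qed
  ultimately have "y \<in> closure (convex hull (insert x (cball 0 1)) - cball 0 1)"
    unfolding closure_sequential by (intro exI[of _ p]) simp
  then show "y \<in> frontier (cball 0 1) \<inter> closure (convex hull (insert x (cball 0 1)) - cball 0 1)"
    using y by simp
qed

text \<open>The point at angle \<open>m\<close> whose tangents to the unit circle touch it at the angles
  \<open>m - h\<close> and \<open>m + h\<close>.\<close>

definition outer_pt :: "real \<Rightarrow> real \<Rightarrow> real ^ 2" where
  "outer_pt m h = (1 / cos h) *\<^sub>R circle_pt m"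

lemma outer_pt_nth: "outer_pt m h $ 1 = cos m / cos h" "outer_pt m h $ 2 = sin m / cos h"
  by (simp_all add: outer_pt_def)

lemma cos_lt_1: "0 < h \<Longrightarrow> h < pi \<Longrightarrow> cos h < (1::real)"
  using cos_monotone_0_pi[of 0 h] by simp

lemma illuminated_arc:
  assumes "\<bar>m\<bar> < pi / 2" "0 < h" "h < pi / 2"
  shows "frontier (cball 0 1) \<inter> closure (convex hull (insert (outer_pt m h) (cball 0 1)) - cball 0 1)
    = circle_pt ` {m-h..m+h}"
proof -
  have c: "0 < cos h" using assms by (intro cos_gt_zero) auto
  have "1 < norm (outer_pt m h)"
    using c cos_lt_1[of h] assms by (simp add: outer_pt_def)
  note illuminated_part_of_sphere[OF this]
  also have "{y. norm y = 1 \<and> 1 \<le> y \<bullet> outer_pt m h} = circle_pt ` {m-h..m+h}"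
  proof (intro equalityI subsetI)
    fix y assume "y \<in> {y. norm y = 1 \<and> 1 \<le> y \<bullet> outer_pt m h}"
    then have y: "norm y = 1" "1 \<le> y \<bullet> outer_pt m h" by auto
    obtain t where t: "t \<in> {-pi<..pi}" "y = circle_pt t" using circle_pt_surj[OF y(1)] .
    have le: "cos h \<le> cos (t - m)"
      using y(2) c by (simp add: t inner_real2 outer_pt_nth cos_diff field_simps)
    have "\<bar>t - m\<bar> \<le> h"
    proof (rule ccontr)
      assume "\<not> \<bar>t - m\<bar> \<le> h"
      then have a: "h < \<bar>t - m\<bar>" by simp
      have "cos \<bar>t - m\<bar> < cos h"
      proof (cases "\<bar>t - m\<bar> \<le> pi")
        case True
        then show ?thesis using a assms by (intro cos_monotone_0_pi) auto
      next
        \<comment> \<open>Here \<open>\<bar>t - m\<bar> < 3 * pi / 2\<close>, so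
          \<open>2 * pi - \<bar>t - m\<bar>\<close> has the same cosine, exceeds
          \<open>pi / 2 > h\<close> and lies where cosine is decreasing.\<close>
        case False
        have "h < 2 * pi - \<bar>t - m\<bar>" "2 * pi - \<bar>t - m\<bar> \<le> pi" using False t assms by auto
        then have "cos (2 * pi - \<bar>t - m\<bar>) < cos h" using assms by (intro cos_monotone_0_pi) auto
        then show ?thesis by (simp add: cos_diff)
      qed
      then show False using le by simp
    qed
    then have "t \<in> {m-h..m+h}" by (auto simp: abs_le_iff)
    then show "y \<in> circle_pt ` {m-h..m+h}" using t(2) by blast
  next
    fix y assume "y \<in> circle_pt ` {m-h..m+h}"
    then obtain t where t: "y = circle_pt t" "t \<in> {m-h..m+h}" by blast
    then have "\<bar>t - m\<bar> \<le> h" by auto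
    then have "cos h \<le> cos \<bar>t - m\<bar>" using assms by (intro cos_monotone_0_pi_le) auto
    then show "y \<in> {y. norm y = 1 \<and> 1 \<le> y \<bullet> outer_pt m h}"
      using c by (simp add: t inner_real2 outer_pt_nth cos_diff field_simps)
  qed
  finally show ?thesis .
qed

lemma circle_pt_mem_arc_iff:
  assumes "\<bar>m\<bar> < pi / 2" "0 < h" "h < pi / 2"
  shows "circle_pt t \<in> circle_pt ` {m-h..m+h} \<and> t \<in> {-pi<..pi} \<longleftrightarrow> t \<in> {m-h..m+h}"
proof -
  have "{m-h..m+h} \<subseteq> {-pi<..pi}" using assms by auto
  then show ?thesis using inj_on_image_mem_iff[OF circle_pt_inj, of t "{m-h..m+h}"] by auto
qed

lemma LINT_surface_measure_arc:
  fixes f :: "real ^ 2 \<Rightarrow> real"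
  assumes mh: "\<bar>m\<bar> < pi / 2" "0 < h" "h < pi / 2" and f [measurable]: "f \<in> borel_measurable borel"
  shows "(LINT y : circle_pt ` {m-h..m+h} | surface_measure (cball 0 1). f y)
    = (LINT t : {m-h..m+h} | lborel. f (circle_pt t))"
proof -
  have [measurable]: "circle_pt \<in> restrict_space lborel {-pi<..pi} \<rightarrow>\<^sub>M borel"
    by (intro measurable_restrict_space1) simp
  have "compact (circle_pt ` {m-h..m+h})"
    by (intro compact_continuous_image continuous_intros compact_Icc)
  then have [measurable]: "circle_pt ` {m-h..m+h} \<in> sets borel"
    by (intro borel_closed compact_imp_closed)
  have "(LINT y : circle_pt ` {m-h..m+h} | surface_measure (cball 0 1). f y)
      = (LINT t | restrict_space lborel {-pi<..pi}. indicat_real (circle_pt ` {m-h..m+h}) (circle_pt t) *\<^sub>R f (circle_pt t))"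
    unfolding set_lebesgue_integral_def surface_measure_disc
    by (subst integral_distr) auto
  also have "\<dots> = (LINT t : {-pi<..pi} | lborel. indicat_real (circle_pt ` {m-h..m+h}) (circle_pt t) *\<^sub>R f (circle_pt t))"
    unfolding set_lebesgue_integral_def by (subst integral_restrict_space) auto
  also have "\<dots> = (LINT t : {m-h..m+h} | lborel. f (circle_pt t))"
    unfolding set_lebesgue_integral_def
    by (intro Bochner_Integration.integral_cong refl)
      (use circle_pt_mem_arc_iff[OF mh] in \<open>auto simp: indicator_def\<close>)
  finally show ?thesis .
qed

text \<open>Membership becomes an inequality for an antiderivative in the angle. The bound
  \<open>b\<close> gives integrability, without which the integral would take its default value 0;
  the finite set \<open>S\<close> allows for jumps of the density.\<close>

lemma outer_pt_in_body_iff: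
  fixes f :: "real ^ 2 \<Rightarrow> real"
  assumes mh: "\<bar>m\<bar> < pi / 2" "0 < h" "h < pi / 2" and f: "f \<in> borel_measurable borel"
    and bound: "\<And>t. norm (f (circle_pt t)) \<le> b"
    and F: "finite S" "\<And>t. t \<in> {m-h<..<m+h} - S \<Longrightarrow> (F has_real_derivative f (circle_pt t)) (at t)"
      "continuous_on {m-h..m+h} F"
  shows "outer_pt m h \<in> illumination_surface_body (cball 0 1) f s \<longleftrightarrow> F (m + h) - F (m - h) \<le> s"
proof -
  have [measurable]: "f \<in> borel_measurable borel" by (rule f)
  have "set_integrable lborel {m-h..m+h} (\<lambda>t. f (circle_pt t))"
    unfolding set_integrable_def
    by (rule integrableI_bounded_set_indicator[where B = b]) (use bound mh in \<open>auto simp: emeasure_lborel_Icc_eq\<close>)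
  then have "(LINT t : {m-h..m+h} | lborel. f (circle_pt t)) = integral {m-h..m+h} (\<lambda>t. f (circle_pt t))"
    by (rule set_borel_integral_eq_integral)
  also have "\<dots> = F (m + h) - F (m - h)"
    by (intro integral_unique fundamental_theorem_of_calculus_interior_strong[OF F(1)])
      (use mh F in \<open>auto simp: has_real_derivative_iff_has_vector_derivative\<close>)
  finally show ?thesis
    unfolding illumination_surface_body_def mem_Collect_eq illuminated_arc[OF mh]
      LINT_surface_measure_arc[OF mh f] by simp
qed

lemma emeasure_surface_measure_disc_singleton:
  "emeasure (surface_measure (cball 0 1)) {y :: real ^ 2} = 0"
proof -
  have [measurable]: "circle_pt \<in> restrict_space lborel {-pi<..pi} \<rightarrow>\<^sub>M borel"
    by (intro measurable_restrict_space1) simp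
  have "finite (circle_pt -` {y} \<inter> {-pi<..pi})"
    by (intro finite_vimage_IntI circle_pt_inj) simp
  then show ?thesis
    by (simp add: surface_measure_disc emeasure_distr emeasure_restrict_space
        space_restrict_space finite_imp_null_set_lborel null_setsD1)
qed

lemma sets_surface_measure [simp]: "sets (surface_measure K) = sets borel"
  by (simp add: surface_measure_def sets.sigma_sets_eq[of borel, simplified])

text \<open>Single points have measure 0 and nothing is integrated off the circle. This replaces an
  \<open>f\<close> prescribed only on the circle minus the axes, and perhaps not Borel elsewhere, by
  the Borel function \<open>quadrant_fun\<close>.\<close>

lemma illumination_surface_body_disc_cong:
  fixes f g :: "real ^ 2 \<Rightarrow> real"
  assumes "countable X" and eq: "\<And>y. y \<in> sphere 0 1 - X \<Longrightarrow> f y = g y"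
  shows "illumination_surface_body (cball 0 1) f s = illumination_surface_body (cball 0 1) g s"
proof -
  have "(LINT y : frontier (cball 0 1) \<inter> A | surface_measure (cball 0 1). f y)
      = (LINT y : frontier (cball 0 1) \<inter> A | surface_measure (cball 0 1). g y)" for A
    unfolding set_lebesgue_integral_def
    by (rule integral_discrete_difference[OF assms(1) emeasure_surface_measure_disc_singleton])
      (use eq in \<open>auto simp: indicator_def\<close>)
  then show ?thesis by (simp add: illumination_surface_body_def)
qed

subsection \<open>The piecewise constant density\<close>

definition quadrant_fun :: "real ^ 2 \<Rightarrow> real" where
  "quadrant_fun y =
    (if 0 < y $ 1 \<and> 0 < y $ 2 \<or> y $ 1 < 0 \<and> y $ 2 < 0 then 1 / (4 * pi)
     else if 0 < y $ 1 \<and> y $ 2 < 0 then 1 / (16 * pi)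
     else if y $ 1 < 0 \<and> 0 < y $ 2 then 23 / (16 * pi) else 0)"

lemma quadrant_fun_measurable: "quadrant_fun \<in> borel_measurable borel"
proof -
  have [measurable]: "(\<lambda>y :: real ^ 2. y $ i) \<in> borel_measurable borel" for i
    by (intro borel_measurable_continuous_onI continuous_intros)
  show ?thesis unfolding quadrant_fun_def by measurable
qed

text \<open>The condition on \<open>m\<close> and \<open>h\<close> keeps the arc in the open right
  half-plane; the two fractions are the masses of its parts above and below the axis.\<close>

lemma outer_pt_in_quadrant_body_iff:
  assumes "0 < h" "\<bar>m\<bar> + h < pi / 2"
  shows "outer_pt m h \<in> illumination_surface_body (cball 0 1) quadrant_fun s
    \<longleftrightarrow> (max (m + h) 0 - max (m - h) 0) / (4 * pi) + (min (m + h) 0 - min (m - h) 0) / (16 * pi) \<le> s"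
proof -
  define F where "F t = max t 0 / (4 * pi) + min t 0 / (16 * pi)" for t :: real
  have "(F has_real_derivative quadrant_fun (circle_pt t)) (at t)" if t: "t \<in> {m-h<..<m+h} - {0}" for t
  proof -
    have t': "-(pi/2) < t" "t < pi/2" "t \<noteq> 0" using t assms by auto
    have c: "0 < cos t" using t' by (intro cos_gt_zero_pi)
    show ?thesis
    proof (cases "0 < t")
      case True
      have "((\<lambda>t. t / (4 * pi)) has_real_derivative 1 / (4 * pi)) (at t)"
        by (auto intro!: derivative_eq_intros)
      then have "(F has_real_derivative 1 / (4 * pi)) (at t)"
        by (rule has_field_derivative_transform_within_open[where S = "{0<..}"]) (use True in \<open>auto simp: F_def\<close>)
      moreover have "0 < sin t" using True t' by (intro sin_gt_zero) auto
      ultimately show ?thesis using c by (simp add: quadrant_fun_def)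
    next
      case False
      have "((\<lambda>t. t / (16 * pi)) has_real_derivative 1 / (16 * pi)) (at t)"
        by (auto intro!: derivative_eq_intros)
      then have "(F has_real_derivative 1 / (16 * pi)) (at t)"
        by (rule has_field_derivative_transform_within_open[where S = "{..<0}"]) (use False t' in \<open>auto simp: F_def\<close>)
      moreover have "0 < sin (- t)" using False t' by (intro sin_gt_zero) auto
      ultimately show ?thesis using c by (simp add: quadrant_fun_def)
    qed
  qed
  moreover have "norm (quadrant_fun (circle_pt t)) \<le> 23 / (16 * pi)" for t
    by (auto simp: quadrant_fun_def field_simps)
  moreover have "continuous_on {m-h..m+h} F"
    unfolding F_def by (intro continuous_intros) auto
  ultimately have "outer_pt m h \<in> illumination_surface_body (cball 0 1) quadrant_fun s
      \<longleftrightarrow> F (m + h) - F (m - h) \<le> s"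
    using assms by (intro outer_pt_in_body_iff[where S = "{0}"] quadrant_fun_measurable) auto
  then show ?thesis by (simp add: F_def diff_divide_distrib algebra_simps)
qed

text \<open>The segment meets the line x = 1 with weights proportional to \<open>1 - x1\<close> and
  \<open>x0 - 1\<close>, so the last hypothesis says, with denominators cleared, that the crossing
  lies above height \<open>t\<close>. The bound \<open>b\<close> will keep the crossing in the range
  of \<open>outer_pt_in_quadrant_body_iff\<close>.\<close>

lemma segment_crosses_above:
  fixes x0 x1 y0 y1 t :: real
  assumes "x1 < 1" "1 < x0" "y0 < b" "y1 < b" "t * (x0 - x1) < (1 - x1) * y0 + (x0 - 1) * y1"
  obtains u where "0 \<le> u" "u \<le> 1" "(1 - u) * x0 + u * x1 = 1"
    "t < (1 - u) * y0 + u * y1" "(1 - u) * y0 + u * y1 < b"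
proof
  let ?u = "(x0 - 1) / (x0 - x1)"
  have u1: "1 - ?u = (1 - x1) / (x0 - x1)" using assms by (simp add: field_simps)
  show u: "0 \<le> ?u" "?u \<le> 1" using assms by (auto simp: field_simps)
  have comb: "(1 - ?u) * p + ?u * p' = ((1 - x1) * p + (x0 - 1) * p') / (x0 - x1)" for p p'
    unfolding u1 by (simp add: add_divide_distrib)
  have "(1 - x1) * x0 + (x0 - 1) * x1 = x0 - x1" by (simp add: algebra_simps)
  then show "(1 - ?u) * x0 + ?u * x1 = 1" unfolding comb using assms by simp
  show "t < (1 - ?u) * y0 + ?u * y1" unfolding comb using assms by (simp add: pos_less_divide_eq)
  show "(1 - ?u) * y0 + ?u * y1 < b" by (rule convex_bound_lt) (use assms u in auto)
qed

text \<open>The largest angle that needs a lower bound is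
  \<open>12 * k \<le> 12 / 80 = 3 / 20\<close>, where
  \<open>x\<^sup>2 / 6 < 1 / 250\<close>.\<close>

lemma sin_ge_near_0:
  fixes x :: real
  assumes "0 \<le> x" "x \<le> 3 / 20"
  shows "249 / 250 * x \<le> sin x"
proof -
  have "\<bar>sin x - x\<bar> \<le> \<bar>x\<bar> ^ 3 / 6"
    using Maclaurin_sin_bound[of x 3] by (simp add: sin_coeff_def eval_nat_numeral)
  moreover have "x ^ 3 \<le> x * (3 / 20)\<^sup>2"
    using assms mult_left_mono[OF power_mono[of x "3/20" 2], of x] by (simp add: power3_eq_cube power2_eq_square mult.assoc)
  ultimately show ?thesis using assms by (simp add: power2_eq_square abs_if split: if_splits)
qed

lemma cos_ge_quadratic: "1 - x\<^sup>2 / 2 \<le> cos (x::real)"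
proof -
  have "cos x = 1 - 2 * (sin (x / 2))\<^sup>2" using cos_double_sin[of "x / 2"] by simp
  moreover have "(sin (x / 2))\<^sup>2 \<le> (x / 2)\<^sup>2"
    using abs_sin_x_le_abs_x[of "x / 2"] by (rule abs_le_square_iff[THEN iffD1])
  ultimately show ?thesis by (simp add: power_divide)
qed

text \<open>To leading order in \<open>k\<close> the two sides are \<open>768 k\<^sup>3\<close> and \<open>792 k\<^sup>3\<close>.\<close>

lemma quadrant_trig_inequality:
  fixes k :: real
  assumes k: "0 < k" "k \<le> 1 / 80"
  shows "sin (8*k) * (cos (3*k) * cos (8*k) - cos (12*k) * cos (11*k))
    < cos (8*k) * ((cos (8*k) - cos (12*k)) * sin (3*k) + (cos (3*k) - cos (11*k)) * sin (12*k))"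
proof -
  define q :: real where "q = 249 / 250"
  have lo: "q * (n * k) \<le> sin (n * k)" if "0 \<le> n" "n \<le> 12" for n
    unfolding q_def using that k mult_mono[of n 12 k "1/80"] by (intro sin_ge_near_0) auto
  have hi: "sin (n * k) \<le> n * k" if "0 \<le> n" for n
    using that k by (intro sin_x_le_x) auto
  have k3: "0 < k ^ 3" using k by simp
  have q0: "0 \<le> q * (n * k)" if "0 \<le> n" for n using that k by (simp add: q_def)
  have s: "0 \<le> sin (n * k)" if "0 \<le> n" "n \<le> 12" for n
    using lo[OF that] q0[OF that(1)] by linarith
  \<comment> \<open>Turning cosine differences into products of sines removes the cancellation, so
    linear bounds on the sines suffice. The coefficients of \<open>k ^ 3\<close> are 8 (17*6 - 3*2)
    = 768 and 2 (10*2*3 + 7*4*12) = 792.\<close>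
  have e1: "cos (8*k) - cos (12*k) = 2 * sin (10*k) * sin (2*k)"
    by (simp add: cos_diff_cos)
  have e2: "cos (3*k) - cos (11*k) = 2 * sin (7*k) * sin (4*k)"
    by (simp add: cos_diff_cos)
  have e3: "cos (3*k) * cos (8*k) - cos (12*k) * cos (11*k) = sin (17*k) * sin (6*k) - sin (3*k) * sin (2*k)"
    by (simp add: cos_times_cos sin_times_sin diff_divide_distrib add_divide_distrib)
  have c8: "199 / 200 \<le> cos (8*k)"
  proof -
    have "k\<^sup>2 \<le> (1/80)\<^sup>2" using k by (intro power_mono) auto
    then show ?thesis using cos_ge_quadratic[of "8*k"] by (simp add: power_mult_distrib power_divide)
  qed
  \<comment> \<open>\<open>96048 / 1000\<close> is \<open>102 - 6 * q\<^sup>2\<close> rounded up.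
    All estimates together must lose less than the roughly 3 percent between 768 and 792.\<close>
  have "sin (8*k) * (sin (17*k) * sin (6*k) - sin (3*k) * sin (2*k)) \<le> (8*k) * (96048 / 1000 * k\<^sup>2)"
  proof (rule mult_mono)
    have "sin (17*k) * sin (6*k) \<le> (17*k) * (6*k)"
      using k by (intro mult_mono hi s) auto
    also have "\<dots> = 102 * k\<^sup>2" by (simp add: power2_eq_square)
    finally have "sin (17*k) * sin (6*k) \<le> 102 * k\<^sup>2" .
    moreover have "(q * (3*k)) * (q * (2*k)) \<le> sin (3*k) * sin (2*k)"
      by (intro mult_mono lo q0 s) auto
    then have "6 * q\<^sup>2 * k\<^sup>2 \<le> sin (3*k) * sin (2*k)" by (simp add: power2_eq_square mult_ac)
    moreover have "102 * k\<^sup>2 - 6 * q\<^sup>2 * k\<^sup>2 \<le> 96048 / 1000 * k\<^sup>2"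
      by (simp add: q_def power_divide)
    ultimately show "sin (17*k) * sin (6*k) - sin (3*k) * sin (2*k) \<le> 96048 / 1000 * k\<^sup>2" by linarith
    show "0 \<le> sin (17*k) * sin (6*k) - sin (3*k) * sin (2*k)"
    proof -
      have "cos (11*k) \<le> cos (8*k)" "cos (12*k) \<le> cos (3*k)" "0 \<le> cos (11*k)" "0 \<le> cos (3*k)"
        using k pi_gt3 by (auto intro!: cos_monotone_0_pi_le cos_ge_zero)
      then have "cos (12*k) * cos (11*k) \<le> cos (3*k) * cos (8*k)" by (intro mult_mono)
      then show ?thesis using e3 by simp
    qed
  qed (use k hi[of 8] in auto)
  also have "\<dots> < 199 / 200 * (q ^ 3 * 792) * k ^ 3"
    using k3 by (simp add: q_def power_divide power2_eq_square power3_eq_cube)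
  also have "199 / 200 * (q ^ 3 * 792) * k ^ 3 = 199 / 200 * (2 * (q ^ 3 * (10*2*3) * k ^ 3) + 2 * (q ^ 3 * (7*4*12) * k ^ 3))"
    by simp
  also have "\<dots> \<le> cos (8*k) * (2 * (sin (10*k) * sin (2*k) * sin (3*k)) + 2 * (sin (7*k) * sin (4*k) * sin (12*k)))"
  proof -
    have prod3: "q ^ 3 * (a * b * c) * k ^ 3 \<le> sin (a*k) * sin (b*k) * sin (c*k)"
      if "0 \<le> a" "a \<le> 12" "0 \<le> b" "b \<le> 12" "0 \<le> c" "c \<le> 12" for a b c
    proof -
      have "q * (a*k) * (q * (b*k)) * (q * (c*k)) \<le> sin (a*k) * sin (b*k) * sin (c*k)"
        using that by (intro mult_mono[OF mult_mono] lo q0 s mult_nonneg_nonneg)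
      then show ?thesis by (simp add: power3_eq_cube mult_ac)
    qed
    have "0 \<le> q ^ 3 * (10*2*3) * k ^ 3" "0 \<le> q ^ 3 * (7*4*12) * k ^ 3"
      using k3 by (simp_all add: q_def)
    then show ?thesis
      using prod3[of 10 2 3] prod3[of 7 4 12] c8
      by (intro mult_mono) linarith+
  qed
  finally show ?thesis unfolding e1 e2 e3 by (simp only: mult.assoc)
qed

text \<open>\<open>P0\<close> and \<open>P1\<close> lie on the boundary of the body, on the two sides of the reentrant corner
  \<open>(1, tan (\<pi> / 32))\<close>; the segment between them meets the line \<open>x = 1\<close> above that corner.\<close>

lemma quadrant_body_not_convex:
  "\<not> convex (illumination_surface_body (cball 0 1) quadrant_fun (1 / 64))"
proof
  let ?S = "illumination_surface_body (cball 0 1) quadrant_fun (1 / 64)"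
  assume conv: "convex ?S"
  \<comment> \<open>Mass 1/64 means that the arc length above the axis plus a quarter of that below
    is \<open>16 * k\<close>. The corner lights \<open>{0..16*k}\<close>, \<open>P0\<close> lights
    \<open>{-8*k..14*k}\<close> and \<open>P1\<close> lights \<open>{4*k..20*k}\<close>.\<close>
  define k where "k = pi / 256"
  have k: "0 < k" "k \<le> 1 / 80" "k < pi / 64" using pi_approx(2) by (auto simp: k_def)
  define P0 where "P0 = outer_pt (3*k) (11*k)"
  define P1 where "P1 = outer_pt (12*k) (8*k)"
  have P0: "P0 \<in> ?S"
    unfolding P0_def
    by (subst outer_pt_in_quadrant_body_iff) (use k in \<open>auto simp: k_def\<close>)
  have P1: "P1 \<in> ?S"
    unfolding P1_def
    by (subst outer_pt_in_quadrant_body_iff) (use k in \<open>auto simp: k_def\<close>)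
  have c: "49/50 \<le> cos (n * k)" if "0 \<le> n" "n \<le> 12" for n
  proof -
    have "(n * k)\<^sup>2 \<le> (12 * (1/80))\<^sup>2" using that k by (intro power_mono mult_mono) auto
    then show ?thesis using cos_ge_quadratic[of "n * k"] by (simp add: power2_eq_square)
  qed
  have s: "sin (n * k) \<le> 3 / 20" if "0 \<le> n" "n \<le> 12" for n
    using sin_x_le_x[of "n * k"] that k mult_mono[of n 12 k "1/80"] by auto
  have c8: "0 < cos (8*k)" and c11: "0 < cos (11*k)" using c[of 8] c[of 11] by auto
  have x1: "P1 $ 1 < 1" using c8 k by (simp add: P1_def outer_pt_nth cos_monotone_0_pi)
  have x0: "1 < P0 $ 1" using c11 k by (simp add: P0_def outer_pt_nth cos_monotone_0_pi)
  have y0: "P0 $ 2 < 1" using s[of 3] c[of 11] c11 by (simp add: P0_def outer_pt_nth)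
  have y1: "P1 $ 2 < 1" using s[of 12] c[of 8] c8 by (simp add: P1_def outer_pt_nth)
  \<comment> \<open>\<open>quadrant_trig_inequality\<close> is the crossing condition for the
    corner's height \<open>tan (8*k)\<close>, multiplied by
    \<open>(cos (8*k))\<^sup>2 * cos (11*k)\<close>.\<close>
  have "tan (8*k) * (P0 $ 1 - P1 $ 1)
      = sin (8*k) * (cos (3*k) * cos (8*k) - cos (12*k) * cos (11*k)) / ((cos (8*k))\<^sup>2 * cos (11*k))"
    using c8 c11 by (simp add: P0_def P1_def outer_pt_nth tan_def field_simps power2_eq_square)
  also have "\<dots> < cos (8*k) * ((cos (8*k) - cos (12*k)) * sin (3*k) + (cos (3*k) - cos (11*k)) * sin (12*k))
      / ((cos (8*k))\<^sup>2 * cos (11*k))"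
    using quadrant_trig_inequality[OF k(1,2)] c8 c11 by (intro divide_strict_right_mono) auto
  also have "\<dots> = (1 - P1 $ 1) * P0 $ 2 + (P0 $ 1 - 1) * P1 $ 2"
    using c8 c11 by (simp add: P0_def P1_def outer_pt_nth field_simps power2_eq_square)
  finally obtain u where u: "0 \<le> u" "u \<le> 1" "(1 - u) * P0 $ 1 + u * P1 $ 1 = 1"
      "tan (8*k) < (1 - u) * P0 $ 2 + u * P1 $ 2" "(1 - u) * P0 $ 2 + u * P1 $ 2 < 1"
    by (rule segment_crosses_above[OF x1 x0 y0 y1])
  define y where "y = (1 - u) * P0 $ 2 + u * P1 $ 2"
  define a where "a = arctan y"
  have a: "8 * k < a" "a < pi / 4"
    using u(4,5) k arctan_less_iff[of "tan (8*k)" y] arctan_less_iff[of y 1]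
    by (auto simp: a_def y_def arctan_tan arctan_one)
  \<comment> \<open>On the line x = 1 the lower contact is at angle 0, so the point lights
    \<open>{0..2*a}\<close>, of mass above 1/64 because \<open>a > 8 * k\<close>.\<close>
  have M: "(1 - u) *\<^sub>R P0 + u *\<^sub>R P1 = outer_pt a a"
  proof -
    have "sin a / cos a = y" unfolding a_def by (metis tan_arctan tan_def)
    moreover have "cos a \<noteq> 0" by (simp add: a_def)
    ultimately show ?thesis
      using u(3) by (simp add: vec_eq_iff forall_2 outer_pt_nth y_def)
  qed
  have "outer_pt a a \<in> ?S"
    using convexD_alt[OF conv P0 P1 u(1,2)] by (simp add: M)
  then have "2 * a / (4 * pi) \<le> 1 / 64"
    using a k by (subst (asm) outer_pt_in_quadrant_body_iff) auto
  then show False using a(1) by (simp add: k_def field_simps)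
qed

subsection \<open>A smooth density\<close>

lemma C_n_on_const: "C_n_on n U (\<lambda>x. c)"
  by (induction n arbitrary: c) (auto simp: frechet_derivative_const)

lemma C_n_on_affine:
  assumes "bounded_linear L"
  shows "C_n_on n U (\<lambda>x. c + L x)"
proof (cases n)
  case 0
  then show ?thesis
    using assms by (simp add: continuous_on_add linear_continuous_on)
next
  case (Suc m)
  have d: "((\<lambda>x. c + L x) has_derivative L) (at x)" for x
    using has_derivative_add[OF has_derivative_const bounded_linear_imp_has_derivative[OF assms]] by simp
  then have "frechet_derivative (\<lambda>x. c + L x) (at x) = L" for x
    using frechet_derivative_at by metis
  then show ?thesis using d by (auto simp: Suc C_n_on_const differentiable_def)
qed

text \<open>The normalisation places the point \<open>(1, 1)\<close>, which lights exactly the first quadrant of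
  the circle, on the boundary of the body for \<open>s = 1 / 64\<close>.\<close>

definition tilted_density :: "real ^ 2 \<Rightarrow> real" where
  "tilted_density y = (1 - y $ 1) / (32 * (pi - 2))"

lemma smooth_tilted_density: "smooth_function_on S tilted_density"
proof -
  have "bounded_linear (\<lambda>y :: real ^ 2. - (1 / (32 * (pi - 2))) * y $ 1)"
    by (intro bounded_linear_const_mult bounded_linear_vec_nth)
  from C_n_on_affine[OF this, of _ UNIV "1 / (32 * (pi - 2))"]
  have "C_n_on n UNIV tilted_density" for n
    by (simp add: tilted_density_def[abs_def] diff_divide_distrib)
  then show ?thesis unfolding smooth_function_on_def by (intro exI[of _ UNIV]) auto
qed

lemma outer_pt_in_tilted_body_iff:
  assumes "\<bar>m\<bar> < pi / 2" "0 < h" "h < pi / 2"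
  shows "outer_pt m h \<in> illumination_surface_body (cball 0 1) tilted_density (1 / 64)
    \<longleftrightarrow> h - cos m * sin h \<le> pi / 4 - 1 / 2"
proof -
  define F where "F t = (t - sin t) / (32 * (pi - 2))" for t :: real
  have "(F has_real_derivative tilted_density (circle_pt t)) (at t)" for t
    unfolding F_def tilted_density_def using pi_gt3 by (auto intro!: derivative_eq_intros)
  moreover have "norm (tilted_density (circle_pt t)) \<le> 2 / (32 * (pi - 2))" for t
    using pi_gt3 cos_le_one[of t] cos_ge_minus_one[of t]
    by (simp add: tilted_density_def divide_right_mono del: cos_le_one cos_ge_minus_one)
  moreover have "tilted_density \<in> borel_measurable borel"
    unfolding tilted_density_def by (intro borel_measurable_continuous_onI continuous_intros) (use pi_gt3 in auto)
  moreover have "continuous_on {m-h..m+h} F"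
    unfolding F_def by (intro continuous_intros) (use pi_gt3 in auto)
  ultimately have "outer_pt m h \<in> illumination_surface_body (cball 0 1) tilted_density (1 / 64)
      \<longleftrightarrow> F (m + h) - F (m - h) \<le> 1 / 64"
    using assms by (intro outer_pt_in_body_iff[where S = "{}"]) auto
  also have "F (m + h) - F (m - h) = (2 * h - 2 * (cos m * sin h)) / (32 * (pi - 2))"
    by (simp add: F_def sin_add sin_diff flip: diff_divide_distrib)
  also have "\<dots> \<le> 1 / 64 \<longleftrightarrow> h - cos m * sin h \<le> pi / 4 - 1 / 2"
    using pi_gt3 by (simp add: pos_divide_le_eq) argo
  finally show ?thesis .
qed

text \<open>\<open>T\<close> is the length of the tangent segments from the point to the circle.\<close>

lemma vector_in_tilted_body_iff:
  assumes "0 < x" "0 < T" "x\<^sup>2 + y\<^sup>2 = 1 + T\<^sup>2"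
  shows "vector [x, y] \<in> illumination_surface_body (cball 0 1) tilted_density (1 / 64)
    \<longleftrightarrow> arctan T - x * T / (1 + T\<^sup>2) \<le> pi / 4 - 1 / 2"
proof -
  \<comment> \<open>\<open>r\<close> is both the distance of the point from the origin and
    \<open>1 / cos (arctan T)\<close>, which makes the point an \<open>outer_pt\<close>.\<close>
  define r where "r = sqrt (1 + T\<^sup>2)"
  have r: "0 < r" "r\<^sup>2 = 1 + T\<^sup>2" by (auto simp: r_def add_pos_nonneg)
  have "1 + (y / x)\<^sup>2 = (r / x)\<^sup>2"
    using assms r by (simp add: field_simps)
  then have m: "sqrt (1 + (y / x)\<^sup>2) = r / x" using r assms by simp
  have cs: "cos (arctan (y / x)) = x / r" "sin (arctan (y / x)) = y / r"
      "cos (arctan T) = 1 / r" "sin (arctan T) = T / r"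
    using assms(1) by (simp_all add: cos_arctan sin_arctan m) (simp_all add: r_def)
  have "(vector [x, y] :: real ^ 2) = outer_pt (arctan (y / x)) (arctan T)"
    using r(1) by (simp add: vec_eq_iff forall_2 outer_pt_nth cs)
  moreover have "\<bar>arctan (y / x)\<bar> < pi / 2" using arctan_bounded[of "y / x"] by (auto simp: abs_less_iff)
  ultimately show ?thesis
    using outer_pt_in_tilted_body_iff[of "arctan (y / x)" "arctan T"] assms(2) arctan_ubound[of T] r(2)
    by (simp add: cs power2_eq_square)
qed

lemma arctan_le_poly:
  assumes "0 \<le> x" shows "arctan x \<le> x - x ^ 3 / 3 + x ^ 5 / 5"
proof -
  have "arctan 0 - (0 - 0 ^ 3 / 3 + 0 ^ 5 / 5) \<ge> arctan x - (x - x ^ 3 / 3 + x ^ 5 / 5)"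
  proof (rule DERIV_nonpos_imp_nonincreasing[OF assms])
    fix t :: real assume "0 \<le> t" "t \<le> x"
    have d: "((\<lambda>x. arctan x - (x - x ^ 3 / 3 + x ^ 5 / 5)) has_real_derivative
        inverse (1 + t\<^sup>2) - (1 - t ^ 2 + t ^ 4)) (at t)"
      by (auto intro!: derivative_eq_intros)
    \<comment> \<open>The derivative of \<open>arctan\<close> is the geometric series in
      \<open>- t\<^sup>2\<close>; this is its remainder after three terms.\<close>
    have e: "inverse (1 + t\<^sup>2) - (1 - t ^ 2 + t ^ 4) = - (t ^ 6 / (1 + t\<^sup>2))"
    proof -
      have "(1 - t ^ 2 + t ^ 4) * (1 + t\<^sup>2) = 1 + t ^ 6" by (simp add: algebra_simps flip: power_add)
      moreover have "1 + t\<^sup>2 \<noteq> 0" using add_pos_nonneg[of 1 "t\<^sup>2"] by simp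
      ultimately show ?thesis by (simp add: divide_simps)
    qed
    have "- (t ^ 6 / (1 + t\<^sup>2)) \<le> 0" by (simp add: add_nonneg_nonneg zero_le_even_power)
    with d[unfolded e] show "\<exists>y. ((\<lambda>x. arctan x - (x - x ^ 3 / 3 + x ^ 5 / 5)) has_real_derivative y) (at t) \<and> y \<le> 0"
      by blast
  qed
  then show ?thesis by simp
qed

lemma arctan_ge_poly:
  assumes "0 \<le> x" shows "x - x ^ 3 / 3 + x ^ 5 / 5 - x ^ 7 / 7 \<le> arctan x"
proof -
  have "arctan 0 - (0 - 0 ^ 3 / 3 + 0 ^ 5 / 5 - 0 ^ 7 / 7) \<le> arctan x - (x - x ^ 3 / 3 + x ^ 5 / 5 - x ^ 7 / 7)"
  proof (rule DERIV_nonneg_imp_nondecreasing[OF assms])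
    fix t :: real assume "0 \<le> t" "t \<le> x"
    have d: "((\<lambda>x. arctan x - (x - x ^ 3 / 3 + x ^ 5 / 5 - x ^ 7 / 7)) has_real_derivative
        inverse (1 + t\<^sup>2) - (1 - t ^ 2 + t ^ 4 - t ^ 6)) (at t)"
      by (auto intro!: derivative_eq_intros)
    have e: "inverse (1 + t\<^sup>2) - (1 - t ^ 2 + t ^ 4 - t ^ 6) = t ^ 8 / (1 + t\<^sup>2)"
    proof -
      have "(1 - t ^ 2 + t ^ 4 - t ^ 6) * (1 + t\<^sup>2) = 1 - t ^ 8" by (simp add: algebra_simps flip: power_add)
      moreover have "1 + t\<^sup>2 \<noteq> 0" using add_pos_nonneg[of 1 "t\<^sup>2"] by simp
      ultimately show ?thesis by (simp add: divide_simps)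
    qed
    have "0 \<le> t ^ 8 / (1 + t\<^sup>2)" by (simp add: add_nonneg_nonneg zero_le_even_power)
    with d[unfolded e] show "\<exists>y. ((\<lambda>x. arctan x - (x - x ^ 3 / 3 + x ^ 5 / 5 - x ^ 7 / 7)) has_real_derivative y) (at t) \<and> 0 \<le> y"
      by blast
  qed
  then show ?thesis by simp
qed

lemma tilted_body_not_convex:
  "\<not> convex (illumination_surface_body (cball 0 1) tilted_density (1 / 64))"
proof
  let ?S = "illumination_surface_body (cball 0 1) tilted_density (1 / 64)"
  assume conv: "convex ?S"
  \<comment> \<open>The tangent lengths have rational squares: 1 at the first point, 4/25 at the
    second, 9/20 at their midpoint. The first point meets the criterion with equality; the other two
    leave slack for the polynomial bounds on \<open>arctan\<close>.\<close>
  have "vector [1, 1] \<in> ?S"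
    using vector_in_tilted_body_iff[of 1 1 1] by (simp add: arctan_one)
  moreover have "vector [7/25, 26/25] \<in> ?S"
    using vector_in_tilted_body_iff[of "7/25" "2/5" "26/25"] arctan_le_poly[of "2/5"] pi_approx(1)
    by (simp add: power_divide)
  ultimately have "(1 - 1/2) *\<^sub>R vector [1, 1] + (1/2) *\<^sub>R (vector [7/25, 26/25] :: real ^ 2) \<in> ?S"
    by (rule convexD_alt[OF conv]) auto
  moreover have "(1 - 1/2) *\<^sub>R vector [1, 1] + (1/2) *\<^sub>R (vector [7/25, 26/25] :: real ^ 2)
      = vector [16/25, 51/50]"
    by (simp add: vec_eq_iff forall_2)
  ultimately have M: "vector [16/25, 51/50] \<in> ?S" by simp
  define T where "T = sqrt (9/20)"
  have T: "67/100 \<le> T" "T \<le> 671/1000" "T\<^sup>2 = 9/20"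
    unfolding T_def by (rule real_le_rsqrt real_le_lsqrt; simp add: power_divide)+ simp
  have "arctan T - 16/25 * T / (1 + 9/20) \<le> pi / 4 - 1 / 2"
    using M T vector_in_tilted_body_iff[of "16/25" T "51/50"] by (simp add: power_divide)
  moreover have "arctan (67/100) \<le> arctan T" using T by (simp add: arctan_le_iff)
  ultimately show False
    using arctan_ge_poly[of "67/100"] T(2) pi_approx(2) by (simp add: power_divide)
qed

theorem mainTheorem12:
  fixes K :: "(real ^ 2) set" and s :: real
  assumes "K = cball 0 1" and "s = 1 / 64"
  shows "(\<forall>f :: real ^ 2 \<Rightarrow> real.
            (\<forall>x \<in> frontier K.
               (0 < x $ 1 \<and> 0 < x $ 2 \<or> x $ 1 < 0 \<and> x $ 2 < 0 \<longrightarrow> f x = 1 / (4 * pi)) \<and>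
               (0 < x $ 1 \<and> x $ 2 < 0 \<longrightarrow> f x = 1 / (16 * pi)) \<and>
               (x $ 1 < 0 \<and> 0 < x $ 2 \<longrightarrow> f x = 23 / (16 * pi)))
            \<longrightarrow> \<not> convex (illumination_surface_body K f s)) \<and>
         (\<exists>f :: real ^ 2 \<Rightarrow> real.
            smooth_function_on (frontier K) f \<and> (\<forall>x \<in> frontier K. 0 \<le> f x) \<and>
            \<not> convex (illumination_surface_body K f s))"
proof (intro conjI allI impI)
  fix f :: "real ^ 2 \<Rightarrow> real"
  assume f: "\<forall>x \<in> frontier K.
               (0 < x $ 1 \<and> 0 < x $ 2 \<or> x $ 1 < 0 \<and> x $ 2 < 0 \<longrightarrow> f x = 1 / (4 * pi)) \<and>
               (0 < x $ 1 \<and> x $ 2 < 0 \<longrightarrow> f x = 1 / (16 * pi)) \<and>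
               (x $ 1 < 0 \<and> 0 < x $ 2 \<longrightarrow> f x = 23 / (16 * pi))"
  \<comment> \<open>These are the only points of the circle with a zero coordinate, that is, where
    the hypothesis leaves \<open>f\<close> free.\<close>
  let ?X = "{vector [1, 0], vector [-1, 0], vector [0, 1], vector [0, -1]} :: (real ^ 2) set"
  have "f y = quadrant_fun y" if y: "y \<in> sphere 0 1 - ?X" for y
  proof -
    have sq: "(y $ 1)\<^sup>2 + (y $ 2)\<^sup>2 = 1" using norm_real2_sq[of y] y by simp
    have "y $ 1 \<noteq> 0 \<and> y $ 2 \<noteq> 0"
      using sq y by (auto simp: vec_eq_iff forall_2 power2_eq_1_iff)
    then have "y $ 1 < 0 \<or> 0 < y $ 1" "y $ 2 < 0 \<or> 0 < y $ 2" by auto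
    then show ?thesis using f y assms(1) by (auto simp: quadrant_fun_def)
  qed
  then have "illumination_surface_body (cball 0 1) f s = illumination_surface_body (cball 0 1) quadrant_fun s"
    by (intro illumination_surface_body_disc_cong[of ?X]) auto
  then show "\<not> convex (illumination_surface_body K f s)"
    unfolding assms using quadrant_body_not_convex by simp
next
  have "0 \<le> tilted_density y" if "y \<in> frontier K" for y
  proof -
    have "\<bar>y $ 1\<bar> \<le> norm y" by (rule component_le_norm_cart)
    then show ?thesis using that assms pi_gt3 by (simp add: tilted_density_def)
  qed
  then show "\<exists>f :: real ^ 2 \<Rightarrow> real.
      smooth_function_on (frontier K) f \<and> (\<forall>x \<in> frontier K. 0 \<le> f x) \<and>
      \<not> convex (illumination_surface_body K f s)"
    using smooth_tilted_density tilted_body_not_convex assms by blast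
qed

end
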